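(* A modal Nelson lattice $\mathbf{N}=\langle\mathbf{A},\blacksquare,\Diamond_N\rangle$ satisfies the equation $\Delta x=\nabla x$ if and only if there exists a modal Heyting algebra $\mathbf{M}=\langle\mathbf{H},\square,\Diamond\rangle$ satisfying $--\square a=-\Diamond -a$ and $-\square -a=--\Diamond a$ for all $a\in H$, such that $\mathbf{N}$ is isomorphic to $\mathbf{N}(\mathbf{M},D(\mathbf{H}))$.
   Context: A Nelson lattice is an involutive residuated lattice $\langle A,\wedge,\vee,*,\Rightarrow,\top,\bot\rangle$ ($\sim a=a\Rightarrow\bot$, $\sim\sim a=a$, $a^2=a*a$) satisfying $((a^2\Rightarrow b)\wedge((\sim b)^2\Rightarrow\sim a))\Rightarrow(a\Rightarrow b)=\top$. A modal Nelson lattice is $\langle\mathbf{A},\blacksquare,\Diamond_N\rangle$ (here $\Diamond_N$ denotes the Nelson-level diamond, written as a black lozenge in the paper) with $\mathbf{A}$ a Nelson lattice such that for all $a,b$: $\Diamond_N a=\sim\blacksquare\sim a$; if $a^2=b^2$ then $(\blacksquare a)^2=(\blacksquare b)^2$ and $(\Diamond_N a)^2=(\Diamond_N b)^2$; and $(\blacksquare a\wedge\Diamond_N(\sim a^2\wedge b))^2=\bot$. The term operations are $\nabla(x)=\sim(\sim x^2)^2$ and $\Delta(x)=(\sim(\sim x)^2)^2$. A modal Heyting algebra is $\langle\mathbf{H},\square,\Diamond\rangle$ with $\mathbf{H}$ a Heyting algebra ($-a=a\rightharpoonup\bot$) and unary $\square,\Diamond$ satisfying $\square a\wedge\Diamond(-a\wedge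 b)=\bot$. $D(\mathbf{H})=\{a\in H:-a=\bot\}$ is the filter of dense elements. $\mathbf{N}(\mathbf{M},D(\mathbf{H}))$ is the twist structure on $\{(x,y)\in H\times H:x\wedge y=\bot,\ x\vee y\in D(\mathbf{H})\}$ with $(x,y)\vee(s,t)=(x\vee s,y\wedge t)$, $(x,y)\wedge(s,t)=(x\wedge s,y\vee t)$, $(x,y)*(s,t)=(x\wedge s,(x\rightharpoonup t)\wedge(s\rightharpoonup y))$, $(x,y)\Rightarrow(s,t)=((x\rightharpoonup s)\wedge(t\rightharpoonup y),x\wedge t)$, $\top=(\top,\bot)$, $\bot=(\bot,\top)$, $\blacksquare(x,y)=(\square x,\Diamond y)$, $\Diamond_N(x,y)=(\Diamond x,\square y)$. *)

theory Defs
  imports "HOL-Algebra.Group"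
begin

section \<open>Bounded lattices as algebras\<close>

record 'a lattice_alg = "'a partial_object" +
  lmeet :: "'a \<Rightarrow> 'a \<Rightarrow> 'a"  (infixl \<open>\<^bold>\<and>\<index>\<close> 70)
  ljoin :: "'a \<Rightarrow> 'a \<Rightarrow> 'a"  (infixl \<open>\<^bold>\<or>\<index>\<close> 65)
  ltop  :: 'a  (\<open>\<^bold>\<top>\<index>\<close>)
  lbot  :: 'a  (\<open>\<^bold>\<bottom>\<index>\<close>)

definition lat_order :: "('a, 'r) lattice_alg_scheme \<Rightarrow> 'a gorder" where
  "lat_order L = \<lparr>carrier = carrier L, eq = (=), le = (\<lambda>x y. x \<^bold>\<and>\<^bsub>L\<^esub> y = x)\<rparr>"

locale lattice_algebra =
  fixes L :: "('a, 'r) lattice_alg_scheme" (structure)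
  assumes bounded_lattice_order: "bounded_lattice (lat_order L)"
    and meet_eq: "\<lbrakk>x \<in> carrier L; y \<in> carrier L\<rbrakk> \<Longrightarrow> x \<^bold>\<and> y = x \<sqinter>\<^bsub>lat_order L\<^esub> y"
    and join_eq: "\<lbrakk>x \<in> carrier L; y \<in> carrier L\<rbrakk> \<Longrightarrow> x \<^bold>\<or> y = x \<squnion>\<^bsub>lat_order L\<^esub> y"
    and top_eq: "\<^bold>\<top> = \<top>\<^bsub>lat_order L\<^esub>"
    and bot_eq: "\<^bold>\<bottom> = \<bottom>\<^bsub>lat_order L\<^esub>"

text \<open>Equivalently, the usual equational axioms of bounded lattices hold on the carrier.\<close>

lemma lattice_algebra_iff:
  "lattice_algebra L \<longleftrightarrow>
    ltop L \<in> carrier L \<and> lbot L \<in> carrier L \<and>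
    (\<forall>x\<in>carrier L. lmeet L x (ltop L) = x \<and> ljoin L x (lbot L) = x) \<and>
    (\<forall>x\<in>carrier L. \<forall>y\<in>carrier L.
      lmeet L x y \<in> carrier L \<and> ljoin L x y \<in> carrier L \<and>
      lmeet L x y = lmeet L y x \<and> ljoin L x y = ljoin L y x \<and>
      lmeet L x (ljoin L x y) = x \<and> ljoin L x (lmeet L x y) = x) \<and>
    (\<forall>x\<in>carrier L. \<forall>y\<in>carrier L. \<forall>z\<in>carrier L.
      lmeet L (lmeet L x y) z = lmeet L x (lmeet L y z) \<and>
      ljoin L (ljoin L x y) z = ljoin L x (ljoin L y z))" (is "_ \<longleftrightarrow> ?R")
proof
  assume "lattice_algebra L"
  then interpret A: lattice_algebra L .
  interpret B: bounded_lattice "lat_order L" by (rule A.bounded_lattice_order)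
  have C: "carrier (lat_order L) = carrier L"
    by (auto simp: lat_order_def)
  have T: "ltop L \<in> carrier L" "lbot L \<in> carrier L"
    using A.top_eq A.bot_eq B.top_closed B.bottom_closed C by auto
  have le: "\<And>x y. x \<sqsubseteq>\<^bsub>lat_order L\<^esub> y \<longleftrightarrow> lmeet L x y = x" by (simp add: lat_order_def)
  have m: "\<And>x y. x \<in> carrier L \<Longrightarrow> y \<in> carrier L \<Longrightarrow> lmeet L x y \<in> carrier L"
    using A.meet_eq B.meet_closed C by auto
  have j: "\<And>x y. x \<in> carrier L \<Longrightarrow> y \<in> carrier L \<Longrightarrow> ljoin L x y \<in> carrier L"
    using A.join_eq B.join_closed C by auto
  have mc: "\<And>x y. x \<in> carrier L \<Longrightarrow> y \<in> carrier L \<Longrightarrow> lmeet L x y = lmeet L y x"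
    using A.meet_eq Lattice.meet_comm by metis
  have jc: "\<And>x y. x \<in> carrier L \<Longrightarrow> y \<in> carrier L \<Longrightarrow> ljoin L x y = ljoin L y x"
    using A.join_eq Lattice.join_comm by metis
  have ma: "\<And>x y z. x \<in> carrier L \<Longrightarrow> y \<in> carrier L \<Longrightarrow> z \<in> carrier L \<Longrightarrow>
     lmeet L (lmeet L x y) z = lmeet L x (lmeet L y z)"
    
  proof -
    fix x y z assume "x \<in> carrier L" "y \<in> carrier L" "z \<in> carrier L"
    then show "lmeet L (lmeet L x y) z = lmeet L x (lmeet L y z)"
      using B.meet_assoc[of x y z] A.meet_eq[of x y] A.meet_eq[of y z] m[of x y] m[of y z]
        A.meet_eq[of "lmeet L x y" z] A.meet_eq[of x "lmeet L y z"] C by simp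
  qed
  have ja: "\<And>x y z. x \<in> carrier L \<Longrightarrow> y \<in> carrier L \<Longrightarrow> z \<in> carrier L \<Longrightarrow>
     ljoin L (ljoin L x y) z = ljoin L x (ljoin L y z)"

  proof -
    fix x y z assume "x \<in> carrier L" "y \<in> carrier L" "z \<in> carrier L"
    then show "ljoin L (ljoin L x y) z = ljoin L x (ljoin L y z)"
      using B.join_assoc[of x y z] A.join_eq[of x y] A.join_eq[of y z] j[of x y] j[of y z]
        A.join_eq[of "ljoin L x y" z] A.join_eq[of x "ljoin L y z"] C by simp
  qed
  have a1: "\<And>x y. x \<in> carrier L \<Longrightarrow> y \<in> carrier L \<Longrightarrow> lmeet L x (ljoin L x y) = x"
    using B.join_left C le A.join_eq by metis
  have a2: "\<And>x y. x \<in> carrier L \<Longrightarrow> y \<in> carrier L \<Longrightarrow> ljoin L x (lmeet L x y) = x"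
  proof -
    fix x y assume xy: "x \<in> carrier L" "y \<in> carrier L"
    have "x \<squnion>\<^bsub>lat_order L\<^esub> lmeet L x y \<sqsubseteq>\<^bsub>lat_order L\<^esub> x"
      by (intro B.join_le) (use xy C m A.meet_eq B.meet_left B.refl in auto)
    moreover have "x \<sqsubseteq>\<^bsub>lat_order L\<^esub> x \<squnion>\<^bsub>lat_order L\<^esub> lmeet L x y"
      by (intro B.join_left) (use xy C m in auto)
    ultimately show "ljoin L x (lmeet L x y) = x"
      using B.le_antisym A.join_eq[OF xy(1) m[OF xy]] C xy m j by metis
  qed
  have t: "\<And>x. x \<in> carrier L \<Longrightarrow> lmeet L x (ltop L) = x"
    using B.top_higher C le A.top_eq by metis
  have b: "\<And>x. x \<in> carrier L \<Longrightarrow> ljoin L x (lbot L) = x"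
    using B.bottom_lower C le A.bot_eq a2 mc T by metis
  show ?R
    by (intro conjI ballI) (assumption | rule T t b a1 a2 ma ja mc jc m j)+
next
  assume R: ?R
  let ?O = "lat_order L" let ?C = "carrier L"
  have T: "ltop L \<in> ?C" "lbot L \<in> ?C" using R by auto
  have t: "\<And>x. x \<in> ?C \<Longrightarrow> lmeet L x (ltop L) = x" and b: "\<And>x. x \<in> ?C \<Longrightarrow> ljoin L x (lbot L) = x"
    using R by auto
  have m: "\<And>x y. x \<in> ?C \<Longrightarrow> y \<in> ?C \<Longrightarrow> lmeet L x y \<in> ?C"
    and j: "\<And>x y. x \<in> ?C \<Longrightarrow> y \<in> ?C \<Longrightarrow> ljoin L x y \<in> ?C" using R by auto
  have mc: "\<And>x y. x \<in> ?C \<Longrightarrow> y \<in> ?C \<Longrightarrow> lmeet L x y = lmeet L y x"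
    and jc: "\<And>x y. x \<in> ?C \<Longrightarrow> y \<in> ?C \<Longrightarrow> ljoin L x y = ljoin L y x" using R by blast+
  have a1: "\<And>x y. x \<in> ?C \<Longrightarrow> y \<in> ?C \<Longrightarrow> lmeet L x (ljoin L x y) = x"
    and a2: "\<And>x y. x \<in> ?C \<Longrightarrow> y \<in> ?C \<Longrightarrow> ljoin L x (lmeet L x y) = x" using R by auto
  have ma: "\<And>x y z. x \<in> ?C \<Longrightarrow> y \<in> ?C \<Longrightarrow> z \<in> ?C \<Longrightarrow> lmeet L (lmeet L x y) z = lmeet L x (lmeet L y z)"
    and ja: "\<And>x y z. x \<in> ?C \<Longrightarrow> y \<in> ?C \<Longrightarrow> z \<in> ?C \<Longrightarrow> ljoin L (ljoin L x y) z = ljoin L x (ljoin L y z)"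
    using R by auto
  have C: "carrier ?O = carrier L" by (auto simp: lat_order_def)
  have le: "\<And>x y. x \<sqsubseteq>\<^bsub>?O\<^esub> y \<longleftrightarrow> lmeet L x y = x" by (simp add: lat_order_def)
  have id: "\<And>x. x \<in> carrier L \<Longrightarrow> lmeet L x x = x" by (metis a1 a2 m)
  have lj: "\<And>x y. x \<in> carrier L \<Longrightarrow> y \<in> carrier L \<Longrightarrow> lmeet L x y = x \<longleftrightarrow> ljoin L x y = y"
    by (metis a1 a2 mc jc)
  interpret P: partial_order ?O
  proof
    show "\<And>x y. x \<in> carrier ?O \<Longrightarrow> y \<in> carrier ?O \<Longrightarrow> x \<sqsubseteq>\<^bsub>?O\<^esub> y \<Longrightarrow> y \<sqsubseteq>\<^bsub>?O\<^esub> x \<Longrightarrow> x .=\<^bsub>?O\<^esub> y"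
      using mc by (simp add: lat_order_def) 
    show "\<And>x y z. x \<in> carrier ?O \<Longrightarrow> y \<in> carrier ?O \<Longrightarrow> z \<in> carrier ?O \<Longrightarrow> x \<sqsubseteq>\<^bsub>?O\<^esub> y \<Longrightarrow> y \<sqsubseteq>\<^bsub>?O\<^esub> z \<Longrightarrow> x \<sqsubseteq>\<^bsub>?O\<^esub> z"
      unfolding C le by (metis ma)
  qed (auto simp: lat_order_def id)
  have gl: "greatest ?O (lmeet L x y) (Lower ?O {x,y})" if "x \<in> carrier L" "y \<in> carrier L" for x y
  proof (rule greatest_LowerI)
    fix z assume "z \<in> Lower ?O {x,y}"
    then have "z \<in> carrier L" "lmeet L z x = z" "lmeet L z y = z"
      using that C le by (auto simp: Lower_def)
    then show "z \<sqsubseteq>\<^bsub>?O\<^esub> lmeet L x y" unfolding le using ma[of z x y] that by simp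
  next
    fix z assume "z \<in> {x,y}"
    then show "lmeet L x y \<sqsubseteq>\<^bsub>?O\<^esub> z" unfolding le
      using ma[of x y y] ma[of y x x] mc[of x y] that id by auto
  qed (use that C m in auto)
  have lu: "least ?O (ljoin L x y) (Upper ?O {x,y})" if xy: "x \<in> carrier L" "y \<in> carrier L" for x y
  proof (rule least_UpperI)
    fix z assume "z \<in> Upper ?O {x,y}"
    then have z: "z \<in> carrier L" "lmeet L x z = x" "lmeet L y z = y"
      using that C le by (auto simp: Upper_def)
    then have "ljoin L x z = z" "ljoin L y z = z" using lj that by auto
    then show "ljoin L x y \<sqsubseteq>\<^bsub>?O\<^esub> z" unfolding le lj[OF j[OF xy] z(1)] using ja[of x y z] that z by simp
  next
    fix z assume "z \<in> {x,y}"
    then show "z \<sqsubseteq>\<^bsub>?O\<^esub> ljoin L x y" unfolding le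
      using a1[of x y] a1[of y x] jc[of x y] that by auto
  qed (use that C j in auto)
  have gt: "greatest ?O (ltop L) (carrier ?O)" using T t le C by (auto simp: greatest_def)
  have lb: "least ?O (lbot L) (carrier ?O)" using T b le C lj jc by (auto simp: least_def)
  have BL: "bounded_lattice ?O"
  proof
  qed (use gt lb gl lu C in blast)+
  show "lattice_algebra L"
  proof (rule lattice_algebra.intro)
    show "bounded_lattice ?O" by fact
    show "ltop L = \<top>\<^bsub>?O\<^esub>" unfolding Order.top_def
      by (rule sym, rule some_equality, rule gt) (rule P.greatest_unique[OF _ gt])
    show "lbot L = \<bottom>\<^bsub>?O\<^esub>" unfolding Order.bottom_def
      by (rule sym, rule some_equality, rule lb) (rule P.least_unique[OF _ lb])
    fix x y assume xy: "x \<in> carrier L" "y \<in> carrier L"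
    show "lmeet L x y = x \<sqinter>\<^bsub>?O\<^esub> y" unfolding meet_def inf_def
      by (rule sym, rule some_equality, rule gl[OF xy]) (rule P.greatest_unique[OF _ gl[OF xy]])
    show "ljoin L x y = x \<squnion>\<^bsub>?O\<^esub> y" unfolding join_def sup_def
      by (rule sym, rule some_equality, rule lu[OF xy]) (rule P.least_unique[OF _ lu[OF xy]])
  qed
qed


section \<open>Modal Nelson lattices\<close>

record 'a residuated_alg = "'a lattice_alg" +
  fus :: "'a \<Rightarrow> 'a \<Rightarrow> 'a"  (infixl \<open>\<^bold>*\<index>\<close> 75)
  res :: "'a \<Rightarrow> 'a \<Rightarrow> 'a"  (infixr \<open>\<^bold>\<Rightarrow>\<index>\<close> 60)

definition rneg :: "('a, 'r) residuated_alg_scheme \<Rightarrow> 'a \<Rightarrow> 'a"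
    (\<open>\<^bold>\<sim>\<index> _\<close> [81] 80) where
  "\<^bold>\<sim>\<^bsub>A\<^esub> x = (x \<^bold>\<Rightarrow>\<^bsub>A\<^esub> \<^bold>\<bottom>\<^bsub>A\<^esub>)"

definition rsq :: "('a, 'r) residuated_alg_scheme \<Rightarrow> 'a \<Rightarrow> 'a"  (\<open>sq\<index>\<close>) where
  "sq\<^bsub>A\<^esub> x = x \<^bold>*\<^bsub>A\<^esub> x"

text \<open>Residuated lattices are bounded, integral and commutative: the lattice top is the
  unit of the commutative monoid operation.\<close>

locale residuated_lattice = lattice_algebra A
  for A :: "('a, 'r) residuated_alg_scheme" (structure) +
  assumes fus_comm_monoid: "comm_monoid \<lparr>carrier = carrier A, mult = fus A, one = \<^bold>\<top>\<rparr>"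
    and res_closed: "\<lbrakk>x \<in> carrier A; y \<in> carrier A\<rbrakk> \<Longrightarrow> x \<^bold>\<Rightarrow> y \<in> carrier A"
    and residuation: "\<lbrakk>x \<in> carrier A; y \<in> carrier A; z \<in> carrier A\<rbrakk> \<Longrightarrow>
      (x \<^bold>* y) \<sqsubseteq>\<^bsub>lat_order A\<^esub> z \<longleftrightarrow> x \<sqsubseteq>\<^bsub>lat_order A\<^esub> (y \<^bold>\<Rightarrow> z)"

locale involutive_residuated_lattice = residuated_lattice +
  assumes involutive: "x \<in> carrier A \<Longrightarrow> \<^bold>\<sim> (\<^bold>\<sim> x) = x"

locale nelson_lattice = involutive_residuated_lattice +
  assumes nelson: "\<lbrakk>x \<in> carrier A; y \<in> carrier A\<rbrakk> \<Longrightarrow>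
      ((sq x \<^bold>\<Rightarrow> y) \<^bold>\<and> (sq (\<^bold>\<sim> y) \<^bold>\<Rightarrow> \<^bold>\<sim> x)) \<^bold>\<Rightarrow> (x \<^bold>\<Rightarrow> y) = \<^bold>\<top>"

record 'a modal_residuated_alg = "'a residuated_alg" +
  nbox :: "'a \<Rightarrow> 'a"  (\<open>\<^bold>\<box>\<index> _\<close> [81] 80)
  ndia :: "'a \<Rightarrow> 'a"  (\<open>\<^bold>\<diamond>\<index> _\<close> [81] 80)

locale modal_nelson_lattice = nelson_lattice A
  for A :: "('a, 'r) modal_residuated_alg_scheme" (structure) +
  assumes nbox_closed: "x \<in> carrier A \<Longrightarrow> \<^bold>\<box> x \<in> carrier A"
    and ndia_closed: "x \<in> carrier A \<Longrightarrow> \<^bold>\<diamond> x \<in> carrier A"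
    and ndia_eq: "x \<in> carrier A \<Longrightarrow> \<^bold>\<diamond> x = \<^bold>\<sim> (\<^bold>\<box> (\<^bold>\<sim> x))"
    and nbox_sq: "\<lbrakk>x \<in> carrier A; y \<in> carrier A; sq x = sq y\<rbrakk> \<Longrightarrow> sq (\<^bold>\<box> x) = sq (\<^bold>\<box> y)"
    and ndia_sq: "\<lbrakk>x \<in> carrier A; y \<in> carrier A; sq x = sq y\<rbrakk> \<Longrightarrow> sq (\<^bold>\<diamond> x) = sq (\<^bold>\<diamond> y)"
    and nbox_ndia: "\<lbrakk>x \<in> carrier A; y \<in> carrier A\<rbrakk> \<Longrightarrow>
      sq (\<^bold>\<box> x \<^bold>\<and> \<^bold>\<diamond> (\<^bold>\<sim> (sq x) \<^bold>\<and> y)) = \<^bold>\<bottom>"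

definition nabla :: "('a, 'r) residuated_alg_scheme \<Rightarrow> 'a \<Rightarrow> 'a"  (\<open>\<nabla>\<index>\<close>) where
  "\<nabla>\<^bsub>A\<^esub> x = \<^bold>\<sim>\<^bsub>A\<^esub> (sq\<^bsub>A\<^esub> (\<^bold>\<sim>\<^bsub>A\<^esub> (sq\<^bsub>A\<^esub> x)))"

definition delta :: "('a, 'r) residuated_alg_scheme \<Rightarrow> 'a \<Rightarrow> 'a"  (\<open>\<Delta>\<index>\<close>) where
  "\<Delta>\<^bsub>A\<^esub> x = sq\<^bsub>A\<^esub> (\<^bold>\<sim>\<^bsub>A\<^esub> (sq\<^bsub>A\<^esub> (\<^bold>\<sim>\<^bsub>A\<^esub> x)))"

definition modal_nelson_iso ::
    "('a, 'r) modal_residuated_alg_scheme \<Rightarrow> ('b, 's) modal_residuated_alg_scheme \<Rightarrow> ('a \<Rightarrow> 'b) set"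
  where
  "modal_nelson_iso A B = {h. bij_betw h (carrier A) (carrier B) \<and>
     h \<^bold>\<top>\<^bsub>A\<^esub> = \<^bold>\<top>\<^bsub>B\<^esub> \<and> h \<^bold>\<bottom>\<^bsub>A\<^esub> = \<^bold>\<bottom>\<^bsub>B\<^esub> \<and>
     (\<forall>x\<in>carrier A. h (\<^bold>\<box>\<^bsub>A\<^esub> x) = \<^bold>\<box>\<^bsub>B\<^esub> (h x) \<and> h (\<^bold>\<diamond>\<^bsub>A\<^esub> x) = \<^bold>\<diamond>\<^bsub>B\<^esub> (h x)) \<and>
     (\<forall>x\<in>carrier A. \<forall>y\<in>carrier A.
        h (x \<^bold>\<and>\<^bsub>A\<^esub> y) = h x \<^bold>\<and>\<^bsub>B\<^esub> h y \<and>
        h (x \<^bold>\<or>\<^bsub>A\<^esub> y) = h x \<^bold>\<or>\<^bsub>B\<^esub> h y \<and>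
        h (x \<^bold>*\<^bsub>A\<^esub> y) = h x \<^bold>*\<^bsub>B\<^esub> h y \<and>
        h (x \<^bold>\<Rightarrow>\<^bsub>A\<^esub> y) = h x \<^bold>\<Rightarrow>\<^bsub>B\<^esub> h y)}"

definition modal_nelson_isomorphic ::
    "('a, 'r) modal_residuated_alg_scheme \<Rightarrow> ('b, 's) modal_residuated_alg_scheme \<Rightarrow> bool"
  where
  "modal_nelson_isomorphic A B \<longleftrightarrow> modal_nelson_iso A B \<noteq> {}"


section \<open>Modal Heyting algebras\<close>

record 'a heyting_alg = "'a lattice_alg" +
  himp :: "'a \<Rightarrow> 'a \<Rightarrow> 'a"  (infixr \<open>\<rightharpoonup>\<index>\<close> 60)

definition hneg :: "('a, 'r) heyting_alg_scheme \<Rightarrow> 'a \<Rightarrow> 'a"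
    (\<open>\<^bold>-\<index> _\<close> [81] 80) where
  "\<^bold>-\<^bsub>H\<^esub> x = (x \<rightharpoonup>\<^bsub>H\<^esub> \<^bold>\<bottom>\<^bsub>H\<^esub>)"

locale heyting_algebra = lattice_algebra H
  for H :: "('a, 'r) heyting_alg_scheme" (structure) +
  assumes himp_closed: "\<lbrakk>x \<in> carrier H; y \<in> carrier H\<rbrakk> \<Longrightarrow> x \<rightharpoonup> y \<in> carrier H"
    and himp_residuation: "\<lbrakk>x \<in> carrier H; y \<in> carrier H; z \<in> carrier H\<rbrakk> \<Longrightarrow>
      (x \<^bold>\<and> y) \<sqsubseteq>\<^bsub>lat_order H\<^esub> z \<longleftrightarrow> x \<sqsubseteq>\<^bsub>lat_order H\<^esub> (y \<rightharpoonup> z)"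

definition dense_elements :: "('a, 'r) heyting_alg_scheme \<Rightarrow> 'a set" where
  "dense_elements H = {x \<in> carrier H. \<^bold>-\<^bsub>H\<^esub> x = \<^bold>\<bottom>\<^bsub>H\<^esub>}"

record 'a modal_heyting_alg = "'a heyting_alg" +
  hbox :: "'a \<Rightarrow> 'a"  (\<open>\<box>\<index> _\<close> [81] 80)
  hdia :: "'a \<Rightarrow> 'a"  (\<open>\<diamond>\<index> _\<close> [81] 80)

locale modal_heyting_algebra = heyting_algebra H
  for H :: "('a, 'r) modal_heyting_alg_scheme" (structure) +
  assumes hbox_closed: "x \<in> carrier H \<Longrightarrow> \<box> x \<in> carrier H"
    and hdia_closed: "x \<in> carrier H \<Longrightarrow> \<diamond> x \<in> carrier H"
    and hbox_hdia: "\<lbrakk>x \<in> carrier H; y \<in> carrier H\<rbrakk> \<Longrightarrow> \<box> x \<^bold>\<and> \<diamond> (\<^bold>- x \<^bold>\<and> y) = \<^bold>\<bottom>"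


section \<open>Twist structures\<close>

definition twist ::
    "('a, 'r) modal_heyting_alg_scheme \<Rightarrow> 'a set \<Rightarrow> ('a \<times> 'a) modal_residuated_alg" where
  "twist M F = \<lparr>
     carrier = {(x, y). x \<in> carrier M \<and> y \<in> carrier M \<and>
                        x \<^bold>\<and>\<^bsub>M\<^esub> y = \<^bold>\<bottom>\<^bsub>M\<^esub> \<and> x \<^bold>\<or>\<^bsub>M\<^esub> y \<in> F},
     lmeet = (\<lambda>(x, y) (s, t). (x \<^bold>\<and>\<^bsub>M\<^esub> s, y \<^bold>\<or>\<^bsub>M\<^esub> t)),
     ljoin = (\<lambda>(x, y) (s, t). (x \<^bold>\<or>\<^bsub>M\<^esub> s, y \<^bold>\<and>\<^bsub>M\<^esub> t)),
     ltop = (\<^bold>\<top>\<^bsub>M\<^esub>, \<^bold>\<bottom>\<^bsub>M\<^esub>),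
     lbot = (\<^bold>\<bottom>\<^bsub>M\<^esub>, \<^bold>\<top>\<^bsub>M\<^esub>),
     fus = (\<lambda>(x, y) (s, t). (x \<^bold>\<and>\<^bsub>M\<^esub> s, (x \<rightharpoonup>\<^bsub>M\<^esub> t) \<^bold>\<and>\<^bsub>M\<^esub> (s \<rightharpoonup>\<^bsub>M\<^esub> y))),
     res = (\<lambda>(x, y) (s, t). ((x \<rightharpoonup>\<^bsub>M\<^esub> s) \<^bold>\<and>\<^bsub>M\<^esub> (t \<rightharpoonup>\<^bsub>M\<^esub> y), x \<^bold>\<and>\<^bsub>M\<^esub> t)),
     nbox = (\<lambda>(x, y). (\<box>\<^bsub>M\<^esub> x, \<diamond>\<^bsub>M\<^esub> y)),
     ndia = (\<lambda>(x, y). (\<diamond>\<^bsub>M\<^esub> x, \<box>\<^bsub>M\<^esub> y))\<rparr>"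

definition double_negation_dual :: "('a, 'r) modal_heyting_alg_scheme \<Rightarrow> bool" where
  "double_negation_dual M \<longleftrightarrow>
     (\<forall>a\<in>carrier M.
        \<^bold>-\<^bsub>M\<^esub> (\<^bold>-\<^bsub>M\<^esub> (\<box>\<^bsub>M\<^esub> a)) = \<^bold>-\<^bsub>M\<^esub> (\<diamond>\<^bsub>M\<^esub> (\<^bold>-\<^bsub>M\<^esub> a)) \<and>
        \<^bold>-\<^bsub>M\<^esub> (\<box>\<^bsub>M\<^esub> (\<^bold>-\<^bsub>M\<^esub> a)) = \<^bold>-\<^bsub>M\<^esub> (\<^bold>-\<^bsub>M\<^esub> (\<diamond>\<^bsub>M\<^esub> a)))"

end

theory Submission
  imports Defs
begin

text \<open>
  In an involutive residuated lattice the Nelson equation says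
  \<open>p * c \<le> p\<^sup>2 * c \<or> p * c\<^sup>2\<close>; for \<open>p = c\<close> it makes every square idempotent.
  Hence the squares form a Heyting algebra \<open>H\<close> with meet \<open>*\<close>, and \<open>x \<mapsto> (x\<^sup>2, (\<sim>x)\<^sup>2)\<close>
  embeds the Nelson lattice into pairs \<open>(a, b)\<close> with \<open>a \<and> b = \<bottom>\<close>. On such pairs
  \<open>\<Delta>(a, b) = (-b, --b)\<close> and \<open>\<nabla>(a, b) = (--a, -a)\<close>, which agree iff \<open>a \<or> b\<close> is dense.
  A pair \<open>(a, b)\<close> with \<open>d = a \<or> b\<close> dense is the image of \<open>a \<or> \<sim>d\<close>, so the image is all of
  \<open>N(M, D(H))\<close>. Applying the density of \<open>\<box>a \<or> \<diamond>b\<close> to the pairs \<open>(a, -a)\<close> and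
  \<open>(-a, a)\<close> gives the two modal identities.
\<close>

section \<open>Order laws of bounded lattices on a carrier\<close>

context lattice_algebra
begin

abbreviation lle (infix \<open>\<preceq>\<close> 50) where "x \<preceq> y \<equiv> x \<sqsubseteq>\<^bsub>lat_order L\<^esub> y"

lemmas lattice_laws = lattice_algebra_axioms[unfolded lattice_algebra_iff]

lemma top_in [simp]: "\<^bold>\<top> \<in> carrier L" and bot_in [simp]: "\<^bold>\<bottom> \<in> carrier L"
  using lattice_laws by blast+

lemma meet_in [simp]: "\<lbrakk>x \<in> carrier L; y \<in> carrier L\<rbrakk> \<Longrightarrow> x \<^bold>\<and> y \<in> carrier L"
  and join_in [simp]: "\<lbrakk>x \<in> carrier L; y \<in> carrier L\<rbrakk> \<Longrightarrow> x \<^bold>\<or> y \<in> carrier L"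
  and meet_commute: "\<lbrakk>x \<in> carrier L; y \<in> carrier L\<rbrakk> \<Longrightarrow> x \<^bold>\<and> y = y \<^bold>\<and> x"
  and join_commute: "\<lbrakk>x \<in> carrier L; y \<in> carrier L\<rbrakk> \<Longrightarrow> x \<^bold>\<or> y = y \<^bold>\<or> x"
  and meet_absorb: "\<lbrakk>x \<in> carrier L; y \<in> carrier L\<rbrakk> \<Longrightarrow> x \<^bold>\<and> (x \<^bold>\<or> y) = x"
  and join_absorb: "\<lbrakk>x \<in> carrier L; y \<in> carrier L\<rbrakk> \<Longrightarrow> x \<^bold>\<or> (x \<^bold>\<and> y) = x"
  using lattice_laws by blast+

lemma meet_associative:
  "\<lbrakk>x \<in> carrier L; y \<in> carrier L; z \<in> carrier L\<rbrakk> \<Longrightarrow> (x \<^bold>\<and> y) \<^bold>\<and> z = x \<^bold>\<and> (y \<^bold>\<and> z)"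
  and join_associative:
  "\<lbrakk>x \<in> carrier L; y \<in> carrier L; z \<in> carrier L\<rbrakk> \<Longrightarrow> (x \<^bold>\<or> y) \<^bold>\<or> z = x \<^bold>\<or> (y \<^bold>\<or> z)"
  using lattice_laws by blast+

lemma meet_top [simp]: "x \<in> carrier L \<Longrightarrow> x \<^bold>\<and> \<^bold>\<top> = x"
  and join_bot [simp]: "x \<in> carrier L \<Longrightarrow> x \<^bold>\<or> \<^bold>\<bottom> = x"
  using lattice_laws by blast+

lemma le_iff_meet: "x \<preceq> y \<longleftrightarrow> x \<^bold>\<and> y = x"
  by (simp add: lat_order_def)

lemma le_iff_join: "\<lbrakk>x \<in> carrier L; y \<in> carrier L\<rbrakk> \<Longrightarrow> x \<preceq> y \<longleftrightarrow> x \<^bold>\<or> y = y"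
  by (metis le_iff_meet meet_absorb join_absorb meet_commute join_commute)

lemma meet_idem [simp]: "x \<in> carrier L \<Longrightarrow> x \<^bold>\<and> x = x"
  by (metis meet_absorb join_absorb meet_in)

lemma le_refl [simp]: "x \<in> carrier L \<Longrightarrow> x \<preceq> x"
  by (simp add: le_iff_meet)

lemma le_antisym: "\<lbrakk>x \<preceq> y; y \<preceq> x; x \<in> carrier L; y \<in> carrier L\<rbrakk> \<Longrightarrow> x = y"
  by (metis le_iff_meet meet_commute)

lemma le_trans: "\<lbrakk>x \<preceq> y; y \<preceq> z; x \<in> carrier L; y \<in> carrier L; z \<in> carrier L\<rbrakk> \<Longrightarrow> x \<preceq> z"
  by (metis le_iff_meet meet_associative)

lemma meet_le1 [simp]: "\<lbrakk>x \<in> carrier L; y \<in> carrier L\<rbrakk> \<Longrightarrow> x \<^bold>\<and> y \<preceq> x"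
  by (metis le_iff_meet meet_associative meet_commute meet_idem meet_in)

lemma meet_le2 [simp]: "\<lbrakk>x \<in> carrier L; y \<in> carrier L\<rbrakk> \<Longrightarrow> x \<^bold>\<and> y \<preceq> y"
  by (metis meet_le1 meet_commute)

lemma le_meetI:
  "\<lbrakk>z \<preceq> x; z \<preceq> y; x \<in> carrier L; y \<in> carrier L; z \<in> carrier L\<rbrakk> \<Longrightarrow> z \<preceq> x \<^bold>\<and> y"
  by (metis le_iff_meet meet_associative)

lemma join_ge1 [simp]: "\<lbrakk>x \<in> carrier L; y \<in> carrier L\<rbrakk> \<Longrightarrow> x \<preceq> x \<^bold>\<or> y"
  by (simp add: le_iff_meet meet_absorb)

lemma join_ge2 [simp]: "\<lbrakk>x \<in> carrier L; y \<in> carrier L\<rbrakk> \<Longrightarrow> y \<preceq> x \<^bold>\<or> y"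
  by (metis join_ge1 join_commute)

lemma join_leI:
  "\<lbrakk>x \<preceq> z; y \<preceq> z; x \<in> carrier L; y \<in> carrier L; z \<in> carrier L\<rbrakk> \<Longrightarrow> x \<^bold>\<or> y \<preceq> z"
  by (metis le_iff_join join_associative join_in)

lemma le_top [simp]: "x \<in> carrier L \<Longrightarrow> x \<preceq> \<^bold>\<top>"
  by (simp add: le_iff_meet)

lemma bot_le [simp]: "x \<in> carrier L \<Longrightarrow> \<^bold>\<bottom> \<preceq> x"
  by (metis le_iff_join join_commute join_bot bot_in)

lemma le_bot_iff: "x \<in> carrier L \<Longrightarrow> x \<preceq> \<^bold>\<bottom> \<longleftrightarrow> x = \<^bold>\<bottom>"
  by (metis le_antisym bot_le bot_in le_refl)

end


section \<open>Pseudocomplements in Heyting algebras\<close>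

context heyting_algebra
begin

notation lle (infix \<open>\<preceq>\<close> 50)

lemma hneg_in [simp]: "x \<in> carrier H \<Longrightarrow> \<^bold>- x \<in> carrier H"
  by (simp add: hneg_def himp_closed)

lemma le_hneg_iff:
  assumes "x \<in> carrier H" "y \<in> carrier H"
  shows "x \<preceq> \<^bold>- y \<longleftrightarrow> x \<^bold>\<and> y = \<^bold>\<bottom>"
  using assms by (simp add: hneg_def himp_residuation[symmetric] le_bot_iff)

lemma meet_hneg [simp]: "x \<in> carrier H \<Longrightarrow> x \<^bold>\<and> \<^bold>- x = \<^bold>\<bottom>"
  by (metis le_hneg_iff le_refl hneg_in meet_commute)

lemma le_hneg_swap: "\<lbrakk>x \<in> carrier H; y \<in> carrier H\<rbrakk> \<Longrightarrow> x \<preceq> \<^bold>- y \<longleftrightarrow> y \<preceq> \<^bold>- x"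
  by (metis le_hneg_iff meet_commute)

lemma le_hneg_hneg: "x \<in> carrier H \<Longrightarrow> x \<preceq> \<^bold>- (\<^bold>- x)"
  by (simp add: le_hneg_iff)

lemma hneg_triple:
  assumes "x \<in> carrier H" shows "\<^bold>- (\<^bold>- (\<^bold>- x)) = \<^bold>- x"
proof (rule le_antisym)
  have "x \<preceq> \<^bold>- (\<^bold>- (\<^bold>- (\<^bold>- x)))"
    using assms le_trans[OF le_hneg_hneg le_hneg_hneg] by simp
  then show "\<^bold>- (\<^bold>- (\<^bold>- x)) \<preceq> \<^bold>- x" using assms le_hneg_swap by simp
qed (use assms le_hneg_hneg in auto)

text \<open>\<open>(x \<rightharpoonup> y) \<and> x\<close> lies below both \<open>x\<close> and
  \<open>y\<close>, hence below their meet \<bottom>. On twist pairs this turns the second component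
  of a square into a pseudocomplement.\<close>

lemma himp_disjoint:
  assumes "x \<in> carrier H" "y \<in> carrier H" "x \<^bold>\<and> y = \<^bold>\<bottom>"
  shows "x \<rightharpoonup> y = \<^bold>- x"
proof (rule le_antisym)
  have "(x \<rightharpoonup> y) \<^bold>\<and> x \<preceq> y"
    using assms by (simp add: himp_residuation himp_closed)
  then have "(x \<rightharpoonup> y) \<^bold>\<and> x \<preceq> x \<^bold>\<and> y"
    using assms by (intro le_meetI) (auto simp: himp_closed)
  then show "x \<rightharpoonup> y \<preceq> \<^bold>- x"
    using assms by (simp add: le_hneg_iff himp_closed le_bot_iff)
  have "\<^bold>- x \<^bold>\<and> x = \<^bold>\<bottom>" using assms by (metis meet_hneg meet_commute hneg_in)
  then show "\<^bold>- x \<preceq> x \<rightharpoonup> y"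
    using assms himp_residuation[of "\<^bold>- x" x y] by simp
qed (use assms in \<open>auto simp: himp_closed\<close>)

lemma top_himp:
  assumes x: "x \<in> carrier H" shows "\<^bold>\<top> \<rightharpoonup> x = x"
proof (rule le_antisym)
  show "\<^bold>\<top> \<rightharpoonup> x \<preceq> x"
    using x himp_residuation[of "\<^bold>\<top> \<rightharpoonup> x" "\<^bold>\<top>" x] by (simp add: himp_closed)
  show "x \<preceq> \<^bold>\<top> \<rightharpoonup> x"
    using x himp_residuation[of x "\<^bold>\<top>" x] by simp
qed (use x in \<open>auto simp: himp_closed\<close>)

text \<open>The intuitionistically valid De Morgan law: by \<open>le_hneg_swap\<close> negation is
  its own adjoint, so it turns joins into meets.\<close>

lemma hneg_join:
  assumes a: "a \<in> carrier H" and b: "b \<in> carrier H"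
  shows "\<^bold>- (a \<^bold>\<or> b) = \<^bold>- a \<^bold>\<and> \<^bold>- b"
proof (rule le_antisym)
  have "a \<preceq> \<^bold>- (\<^bold>- (a \<^bold>\<or> b))" "b \<preceq> \<^bold>- (\<^bold>- (a \<^bold>\<or> b))"
    using a b le_hneg_hneg[of "a \<^bold>\<or> b"]
      le_trans[OF join_ge1[of a b]] le_trans[OF join_ge2[of a b]] by auto
  then show "\<^bold>- (a \<^bold>\<or> b) \<preceq> \<^bold>- a \<^bold>\<and> \<^bold>- b"
    using a b le_hneg_swap by (intro le_meetI) auto
  have "a \<preceq> \<^bold>- (\<^bold>- a \<^bold>\<and> \<^bold>- b)" "b \<preceq> \<^bold>- (\<^bold>- a \<^bold>\<and> \<^bold>- b)"
    using a b by (auto simp: le_hneg_swap[of _ "\<^bold>- a \<^bold>\<and> \<^bold>- b"])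
  then have "a \<^bold>\<or> b \<preceq> \<^bold>- (\<^bold>- a \<^bold>\<and> \<^bold>- b)"
    using a b by (intro join_leI) auto
  then show "\<^bold>- a \<^bold>\<and> \<^bold>- b \<preceq> \<^bold>- (a \<^bold>\<or> b)"
    using a b le_hneg_swap by simp
qed (use a b in auto)

text \<open>Density reads \<open>-a \<and> -b = \<bottom>\<close>, so \<open>-b\<close> lies below
  \<open>--a\<close>. Disjointness puts \<open>b\<close> below \<open>-a = ---a\<close>, and
  swapping the negation gives the other inequality. Both directions of the equivalence rest on this
  bridge.\<close>

lemma hneg_eq_of_dense_join:
  assumes a: "a \<in> carrier H" and b: "b \<in> carrier H"
    and disj: "a \<^bold>\<and> b = \<^bold>\<bottom>" and dense: "\<^bold>- (a \<^bold>\<or> b) = \<^bold>\<bottom>"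
  shows "\<^bold>- b = \<^bold>- (\<^bold>- a)"
proof (rule le_antisym)
  show "\<^bold>- b \<preceq> \<^bold>- (\<^bold>- a)"
    using a b dense by (metis hneg_join le_hneg_iff hneg_in meet_commute)
  have "b \<preceq> \<^bold>- a" using a b disj by (metis le_hneg_iff meet_commute)
  then show "\<^bold>- (\<^bold>- a) \<preceq> \<^bold>- b"
    using a b hneg_triple le_hneg_swap[of "\<^bold>- (\<^bold>- a)" b] by simp
qed (use a b in auto)

end


section \<open>Negation, square and the identity \<Delta> = \<nabla> in twist structures\<close>

lemma twist_neg:
  assumes "heyting_algebra M" "a \<in> carrier M" "b \<in> carrier M" "a \<^bold>\<and>\<^bsub>M\<^esub> b = \<^bold>\<bottom>\<^bsub>M\<^esub>"
  shows "\<^bold>\<sim>\<^bsub>twist M F\<^esub> (a, b) = (b, a)"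
proof -
  interpret heyting_algebra M by fact
  have "b \<^bold>\<and>\<^bsub>M\<^esub> a = \<^bold>\<bottom>\<^bsub>M\<^esub>" using assms meet_commute by simp
  \<comment> \<open>The residual of \<open>(a, b)\<close> into \<open>(\<bottom>, \<top>)\<close>
    computes to \<open>(-a \<and> (\<top> \<rightharpoonup> b), a)\<close>; disjointness puts
    \<open>b\<close> below \<open>-a\<close>, so the first component collapses to
    \<open>b\<close>.\<close>
  then have "b \<^bold>\<and>\<^bsub>M\<^esub> \<^bold>-\<^bsub>M\<^esub> a = b" using assms by (simp flip: le_iff_meet add: le_hneg_iff)
  then show ?thesis
    using assms meet_commute[of "\<^bold>-\<^bsub>M\<^esub> a" b]
    by (simp add: twist_def rneg_def top_himp flip: hneg_def)
qed

lemma twist_sq: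
  assumes "heyting_algebra M" "a \<in> carrier M" "b \<in> carrier M" "a \<^bold>\<and>\<^bsub>M\<^esub> b = \<^bold>\<bottom>\<^bsub>M\<^esub>"
  shows "sq\<^bsub>twist M F\<^esub> (a, b) = (a, \<^bold>-\<^bsub>M\<^esub> a)"
proof -
  interpret heyting_algebra M by fact
  show ?thesis using assms by (simp add: twist_def rsq_def himp_disjoint)
qed

lemma twist_delta_eq_nabla:
  assumes M: "heyting_algebra M" and p: "p \<in> carrier (twist M (dense_elements M))"
  shows "\<Delta>\<^bsub>twist M (dense_elements M)\<^esub> p = \<nabla>\<^bsub>twist M (dense_elements M)\<^esub> p"
proof -
  interpret heyting_algebra M by fact
  obtain a b where [simp]: "p = (a, b)" by (cases p)
  have [simp]: "a \<in> carrier M" "b \<in> carrier M" and ab: "a \<^bold>\<and>\<^bsub>M\<^esub> b = \<^bold>\<bottom>\<^bsub>M\<^esub>"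
    and d: "\<^bold>-\<^bsub>M\<^esub> (a \<^bold>\<or>\<^bsub>M\<^esub> b) = \<^bold>\<bottom>\<^bsub>M\<^esub>"
    using p by (auto simp: twist_def dense_elements_def)
  \<comment> \<open>Disjointness and density are symmetric in the two components; the swapped form
    gives \<open>-a = --b\<close> beside \<open>-b = --a\<close>, one equation for each component of
    the result.\<close>
  have ba: "b \<^bold>\<and>\<^bsub>M\<^esub> a = \<^bold>\<bottom>\<^bsub>M\<^esub>" "\<^bold>-\<^bsub>M\<^esub> (b \<^bold>\<or>\<^bsub>M\<^esub> a) = \<^bold>\<bottom>\<^bsub>M\<^esub>"
    using ab d meet_commute join_commute by simp_all
  have c: "\<^bold>-\<^bsub>M\<^esub> x \<^bold>\<and>\<^bsub>M\<^esub> x = \<^bold>\<bottom>\<^bsub>M\<^esub>" if "x \<in> carrier M" for x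
    using that meet_commute by simp
  let ?T = "twist M (dense_elements M)"
  have delta: "\<Delta>\<^bsub>?T\<^esub> (a, b) = (\<^bold>-\<^bsub>M\<^esub> b, \<^bold>-\<^bsub>M\<^esub> (\<^bold>-\<^bsub>M\<^esub> b))"
    using ab by (simp add: delta_def twist_neg[OF M] twist_sq[OF M] ba c)
  have nabla: "\<nabla>\<^bsub>?T\<^esub> (a, b) = (\<^bold>-\<^bsub>M\<^esub> (\<^bold>-\<^bsub>M\<^esub> a), \<^bold>-\<^bsub>M\<^esub> a)"
    using ab by (simp add: nabla_def twist_neg[OF M] twist_sq[OF M] c)
  show ?thesis
    using hneg_eq_of_dense_join[OF _ _ ab d] hneg_eq_of_dense_join[OF _ _ ba]
    by (simp add: delta nabla)
qed

text \<open>An isomorphism commutes with \<Delta> and \<nabla>, both built from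
  \<open>\<sim>\<close> and \<open>sq\<close>, and its injectivity reflects the identity from the
  twist structure back to \<open>N\<close>.\<close>

lemma delta_eq_nabla_if_isomorphic_twist:
  assumes N: "modal_nelson_lattice N" and M: "heyting_algebra M"
    and iso: "modal_nelson_isomorphic N (twist M (dense_elements M))"
    and x: "x \<in> carrier N"
  shows "\<Delta>\<^bsub>N\<^esub> x = \<nabla>\<^bsub>N\<^esub> x"
proof -
  interpret N: modal_nelson_lattice N by fact
  interpret F: comm_monoid "\<lparr>carrier = carrier N, mult = fus N, one = \<^bold>\<top>\<^bsub>N\<^esub>\<rparr>"
    by (rule N.fus_comm_monoid)
  let ?T = "twist M (dense_elements M)"
  obtain h where h: "h \<in> modal_nelson_iso N ?T"
    using iso by (auto simp: modal_nelson_isomorphic_def)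
  \<comment> \<open>The homomorphism equations hold on the carrier only, so pushing \<open>h\<close>
    through nested terms calls for closure.\<close>
  have sq_in: "sq\<^bsub>N\<^esub> y \<in> carrier N" if "y \<in> carrier N" for y
    using F.m_closed[of y y] that by (simp add: rsq_def)
  have neg_in: "\<^bold>\<sim>\<^bsub>N\<^esub> y \<in> carrier N" if "y \<in> carrier N" for y
    using that by (simp add: rneg_def N.res_closed)
  have "h (\<^bold>\<sim>\<^bsub>N\<^esub> y) = \<^bold>\<sim>\<^bsub>?T\<^esub> (h y)" "h (sq\<^bsub>N\<^esub> y) = sq\<^bsub>?T\<^esub> (h y)" if "y \<in> carrier N" for y
    using that h by (auto simp: modal_nelson_iso_def rneg_def rsq_def)
  then have "h (\<Delta>\<^bsub>N\<^esub> x) = \<Delta>\<^bsub>?T\<^esub> (h x)" "h (\<nabla>\<^bsub>N\<^esub> x) = \<nabla>\<^bsub>?T\<^esub> (h x)"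
    using x sq_in neg_in by (simp_all add: delta_def nabla_def)
  moreover have bij: "bij_betw h (carrier N) (carrier ?T)"
    using h by (simp add: modal_nelson_iso_def)
  moreover have "\<Delta>\<^bsub>N\<^esub> x \<in> carrier N" "\<nabla>\<^bsub>N\<^esub> x \<in> carrier N"
    using x sq_in neg_in by (simp_all add: delta_def nabla_def)
  ultimately show ?thesis
    using twist_delta_eq_nabla[OF M bij_betwE[OF bij, rule_format, OF x]]
    by (simp add: inj_onD[OF bij_betw_imp_inj_on[OF bij]])
qed


section \<open>Fusion, squares and negation in residuated lattices\<close>

context residuated_lattice
begin

notation lle (infix \<open>\<preceq>\<close> 50)

interpretation F: comm_monoid "\<lparr>carrier = carrier A, mult = fus A, one = \<^bold>\<top>\<rparr>"
  by (rule fus_comm_monoid)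

lemma fus_in [simp]: "\<lbrakk>x \<in> carrier A; y \<in> carrier A\<rbrakk> \<Longrightarrow> x \<^bold>* y \<in> carrier A"
  and fus_commute: "\<lbrakk>x \<in> carrier A; y \<in> carrier A\<rbrakk> \<Longrightarrow> x \<^bold>* y = y \<^bold>* x"
  and fus_assoc:
    "\<lbrakk>x \<in> carrier A; y \<in> carrier A; z \<in> carrier A\<rbrakk> \<Longrightarrow> (x \<^bold>* y) \<^bold>* z = x \<^bold>* (y \<^bold>* z)"
  and fus_left_commute:
    "\<lbrakk>x \<in> carrier A; y \<in> carrier A; z \<in> carrier A\<rbrakk> \<Longrightarrow> x \<^bold>* (y \<^bold>* z) = y \<^bold>* (x \<^bold>* z)"
  and fus_top [simp]: "x \<in> carrier A \<Longrightarrow> x \<^bold>* \<^bold>\<top> = x"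
  and top_fus [simp]: "x \<in> carrier A \<Longrightarrow> \<^bold>\<top> \<^bold>* x = x"
  using F.m_closed[of x y] F.m_comm[of x y] F.m_assoc[of x y z] F.m_lcomm[of x y z]
    F.r_one[of x] F.l_one[of x]
  by simp_all

lemmas fus_ac = fus_assoc fus_commute fus_left_commute

lemma res_in [simp]: "\<lbrakk>x \<in> carrier A; y \<in> carrier A\<rbrakk> \<Longrightarrow> x \<^bold>\<Rightarrow> y \<in> carrier A"
  by (rule res_closed)

lemma rneg_in [simp]: "x \<in> carrier A \<Longrightarrow> \<^bold>\<sim> x \<in> carrier A"
  by (simp add: rneg_def)

lemma rsq_in [simp]: "x \<in> carrier A \<Longrightarrow> sq x \<in> carrier A"
  by (simp add: rsq_def)

lemma res_fus_le: "\<lbrakk>x \<in> carrier A; y \<in> carrier A\<rbrakk> \<Longrightarrow> (x \<^bold>\<Rightarrow> y) \<^bold>* x \<preceq> y"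
  by (simp add: residuation)

lemma fus_mono_left:
  assumes "x \<preceq> y" "x \<in> carrier A" "y \<in> carrier A" "z \<in> carrier A"
  shows "x \<^bold>* z \<preceq> y \<^bold>* z"
proof -
  have "y \<preceq> z \<^bold>\<Rightarrow> (y \<^bold>* z)" using assms by (simp flip: residuation)
  then have "x \<preceq> z \<^bold>\<Rightarrow> (y \<^bold>* z)" using assms le_trans[of x y] by simp
  then show ?thesis using assms by (simp add: residuation)
qed

lemma fus_mono:
  assumes "x \<preceq> y" "u \<preceq> v" "x \<in> carrier A" "y \<in> carrier A" "u \<in> carrier A" "v \<in> carrier A"
  shows "x \<^bold>* u \<preceq> y \<^bold>* v"
proof (rule le_trans)
  show "x \<^bold>* u \<preceq> y \<^bold>* u" using assms by (intro fus_mono_left)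
  show "y \<^bold>* u \<preceq> y \<^bold>* v"
    using assms fus_mono_left[of u v y] by (simp add: fus_commute[of y])
qed (use assms in auto)

lemma fus_le1: "\<lbrakk>x \<in> carrier A; y \<in> carrier A\<rbrakk> \<Longrightarrow> x \<^bold>* y \<preceq> x"
  using fus_mono[of x x y "\<^bold>\<top>"] by simp

lemma fus_le2: "\<lbrakk>x \<in> carrier A; y \<in> carrier A\<rbrakk> \<Longrightarrow> x \<^bold>* y \<preceq> y"
  using fus_mono[of x "\<^bold>\<top>" y y] by simp

text \<open>Fusion with \<open>z\<close> is left adjoint to the residual by \<open>z\<close>, so it
  distributes over joins; products of joins are expanded with this one factor at a time.\<close>

lemma fus_join_leI:
  assumes "x \<^bold>* z \<preceq> w" "y \<^bold>* z \<preceq> w"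
    "x \<in> carrier A" "y \<in> carrier A" "z \<in> carrier A" "w \<in> carrier A"
  shows "(x \<^bold>\<or> y) \<^bold>* z \<preceq> w"
  using assms by (simp add: residuation join_leI)

lemma rsq_mono: "\<lbrakk>x \<preceq> y; x \<in> carrier A; y \<in> carrier A\<rbrakk> \<Longrightarrow> sq x \<preceq> sq y"
  by (simp add: rsq_def fus_mono)

lemma rsq_le: "x \<in> carrier A \<Longrightarrow> sq x \<preceq> x"
  by (simp add: rsq_def fus_le1)

lemma rsq_fus: "\<lbrakk>x \<in> carrier A; y \<in> carrier A\<rbrakk> \<Longrightarrow> sq (x \<^bold>* y) = sq x \<^bold>* sq y"
  by (simp add: rsq_def fus_ac)

lemma le_rneg_iff:
  "\<lbrakk>x \<in> carrier A; y \<in> carrier A\<rbrakk> \<Longrightarrow> x \<preceq> \<^bold>\<sim> y \<longleftrightarrow> x \<^bold>* y = \<^bold>\<bottom>"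
  by (simp add: rneg_def residuation[symmetric] le_bot_iff)

lemma bot_fus [simp]: "x \<in> carrier A \<Longrightarrow> \<^bold>\<bottom> \<^bold>* x = \<^bold>\<bottom>"
  using fus_le1[of "\<^bold>\<bottom>" x] by (simp add: le_bot_iff)

lemma rsq_top [simp]: "sq \<^bold>\<top> = \<^bold>\<top>" and rsq_bot [simp]: "sq \<^bold>\<bottom> = \<^bold>\<bottom>"
  by (simp_all add: rsq_def)

lemma rneg_fus [simp]: "x \<in> carrier A \<Longrightarrow> \<^bold>\<sim> x \<^bold>* x = \<^bold>\<bottom>"
  using le_rneg_iff[of "\<^bold>\<sim> x" x] by simp

lemma rsq_disjoint: "x \<in> carrier A \<Longrightarrow> sq x \<^bold>* sq (\<^bold>\<sim> x) = \<^bold>\<bottom>"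
  using fus_commute[of x "\<^bold>\<sim> x"] by (simp flip: rsq_fus)

lemma rneg_top [simp]: "\<^bold>\<sim> \<^bold>\<top> = \<^bold>\<bottom>"
  using rneg_fus[of "\<^bold>\<top>"] fus_top[of "\<^bold>\<sim> \<^bold>\<top>"] by simp

lemma le_rneg_swap: "\<lbrakk>x \<in> carrier A; y \<in> carrier A\<rbrakk> \<Longrightarrow> x \<preceq> \<^bold>\<sim> y \<longleftrightarrow> y \<preceq> \<^bold>\<sim> x"
  by (simp add: le_rneg_iff fus_commute)

text \<open>Currying: \<open>z\<close> lies below either side iff
  \<open>z * x * y = \<bottom>\<close>.\<close>

lemma rneg_fus_eq_res:
  assumes "x \<in> carrier A" "y \<in> carrier A"
  shows "\<^bold>\<sim> (x \<^bold>* y) = x \<^bold>\<Rightarrow> \<^bold>\<sim> y"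
  using assms
  by (intro le_antisym)
    (simp_all add: le_rneg_iff fus_assoc flip: residuation,
      metis res_fus_le rneg_in le_rneg_iff res_in fus_in fus_assoc)

end


section \<open>De Morgan laws for an involutive negation\<close>

context involutive_residuated_lattice
begin

notation lle (infix \<open>\<preceq>\<close> 50)

lemma rneg_mono_iff: "\<lbrakk>x \<in> carrier A; y \<in> carrier A\<rbrakk> \<Longrightarrow> \<^bold>\<sim> x \<preceq> \<^bold>\<sim> y \<longleftrightarrow> y \<preceq> x"
  by (simp add: le_rneg_swap[of _ y] involutive)

lemma rneg_bot [simp]: "\<^bold>\<sim> \<^bold>\<bottom> = \<^bold>\<top>"
  using involutive[of "\<^bold>\<top>"] by simp

lemma rneg_join:
  assumes "x \<in> carrier A" "y \<in> carrier A"
  shows "\<^bold>\<sim> (x \<^bold>\<or> y) = \<^bold>\<sim> x \<^bold>\<and> \<^bold>\<sim> y"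
proof (rule le_antisym)
  show "\<^bold>\<sim> (x \<^bold>\<or> y) \<preceq> \<^bold>\<sim> x \<^bold>\<and> \<^bold>\<sim> y"
    using assms by (intro le_meetI) (auto simp: rneg_mono_iff)
  have "x \<^bold>\<or> y \<preceq> \<^bold>\<sim> (\<^bold>\<sim> x \<^bold>\<and> \<^bold>\<sim> y)"
    using assms by (intro join_leI) (auto simp: le_rneg_swap[of _ "\<^bold>\<sim> x \<^bold>\<and> \<^bold>\<sim> y"])
  then show "\<^bold>\<sim> x \<^bold>\<and> \<^bold>\<sim> y \<preceq> \<^bold>\<sim> (x \<^bold>\<or> y)"
    using assms le_rneg_swap by simp
qed (use assms in auto)

lemma rneg_meet:
  assumes "x \<in> carrier A" "y \<in> carrier A"
  shows "\<^bold>\<sim> (x \<^bold>\<and> y) = \<^bold>\<sim> x \<^bold>\<or> \<^bold>\<sim> y"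
  using assms rneg_join[of "\<^bold>\<sim> x" "\<^bold>\<sim> y"] involutive[of "\<^bold>\<sim> x \<^bold>\<or> \<^bold>\<sim> y"] by (simp add: involutive)

lemma res_eq_rneg_fus:
  "\<lbrakk>x \<in> carrier A; y \<in> carrier A\<rbrakk> \<Longrightarrow> x \<^bold>\<Rightarrow> y = \<^bold>\<sim> (x \<^bold>* \<^bold>\<sim> y)"
  by (simp add: rneg_fus_eq_res involutive)

end


section \<open>The Nelson inequality and the behaviour of squares\<close>

context nelson_lattice
begin

notation lle (infix \<open>\<preceq>\<close> 50)

lemma nelson_le:
  assumes "x \<in> carrier A" "y \<in> carrier A"
  shows "(sq x \<^bold>\<Rightarrow> y) \<^bold>\<and> (sq (\<^bold>\<sim> y) \<^bold>\<Rightarrow> \<^bold>\<sim> x) \<preceq> x \<^bold>\<Rightarrow> y"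
  using assms nelson[OF assms] residuation[of "\<^bold>\<top>" "(sq x \<^bold>\<Rightarrow> y) \<^bold>\<and> (sq (\<^bold>\<sim> y) \<^bold>\<Rightarrow> \<^bold>\<sim> x)" "x \<^bold>\<Rightarrow> y"]
  by simp

text \<open>Put \<open>\<sim> y\<close> for \<open>y\<close> in the Nelson inequality and write each
  residual as a negated product: the meet of negations is a negated join, and cancelling
  \<open>\<sim>\<close> reverses the inequality.\<close>

lemma fus_le_join_fus_sq:
  assumes x: "x \<in> carrier A" and y: "y \<in> carrier A"
  shows "x \<^bold>* y \<preceq> (sq x \<^bold>* y) \<^bold>\<or> (sq y \<^bold>* x)"
  using nelson_le[of x "\<^bold>\<sim> y"] x y
  by (simp add: res_eq_rneg_fus involutive rneg_mono_iff flip: rneg_join)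

lemma rsq_idem [simp]:
  assumes x: "x \<in> carrier A" shows "sq (sq x) = sq x"
proof (rule le_antisym)
  \<comment> \<open>With both arguments equal to \<open>x\<close> the two joinands coincide, so x^2
    \<le> x^3; multiplying by \<open>x\<close> then yields x^3 \<le> x^4.\<close>
  have cube: "sq x \<preceq> sq x \<^bold>* x"
    using fus_le_join_fus_sq[OF x x] le_iff_join[of "sq x \<^bold>* x" "sq x \<^bold>* x"] x
    by (simp flip: rsq_def)
  have "sq x \<^bold>* x \<preceq> (sq x \<^bold>* x) \<^bold>* x"
    using x cube by (intro fus_mono_left) auto
  then have "sq x \<preceq> (sq x \<^bold>* x) \<^bold>* x"
    using x cube le_trans[of "sq x" "sq x \<^bold>* x"] by simp
  then show "sq x \<preceq> sq (sq x)" using x by (simp add: rsq_def fus_assoc)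
qed (use x in \<open>auto intro: rsq_le\<close>)

text \<open>Since \<open>sq\<close> is idempotent, its image is its set of fixed points; membership
  can then be used without naming a preimage.\<close>

lemma mem_squares_iff: "e \<in> sq ` carrier A \<longleftrightarrow> e \<in> carrier A \<and> sq e = e"
proof
  assume "e \<in> carrier A \<and> sq e = e"
  then show "e \<in> sq ` carrier A" by (intro image_eqI[of e _ e]) auto
qed auto

text \<open>The adjunction that makes \<open>sq\<close> an interior operator whose open elements are
  the idempotents.\<close>

lemma le_rsq_iff:
  assumes "e \<in> carrier A" "x \<in> carrier A" "sq e = e"
  shows "e \<preceq> sq x \<longleftrightarrow> e \<preceq> x"
  using assms rsq_mono[of e x] rsq_le[of x] le_trans[of e "sq x" x] by auto

text \<open>This makes fusion the meet of idempotents: if \<open>e \<le> f\<close> then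
  \<open>e = e * e \<le> e * f\<close>.\<close>

lemma idempotent_le_iff:
  assumes "e \<in> carrier A" "f \<in> carrier A" "sq e = e"
  shows "e \<^bold>* f = e \<longleftrightarrow> e \<preceq> f"
proof
  assume "e \<^bold>* f = e" then show "e \<preceq> f" using fus_le2[of e f] assms by simp
next
  assume "e \<preceq> f"
  then have "e \<preceq> e \<^bold>* f" using assms fus_mono[of e e e f] by (simp flip: rsq_def)
  then show "e \<^bold>* f = e" using assms by (intro le_antisym) (auto intro: fus_le1)
qed

text \<open>\<open>sq (x \<and> y)\<close> equals its own square, whose two factors lie below
  \<open>sq x\<close> and \<open>sq y\<close>; conversely fusion lies below the meet. Squaring thus
  does not distinguish meet from fusion.\<close>

lemma rsq_meet:
  assumes "x \<in> carrier A" "y \<in> carrier A"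
  shows "sq (x \<^bold>\<and> y) = sq x \<^bold>* sq y"
proof (rule le_antisym)
  have "sq (x \<^bold>\<and> y) \<preceq> sq x" "sq (x \<^bold>\<and> y) \<preceq> sq y" using assms by (auto intro: rsq_mono)
  then have "sq (x \<^bold>\<and> y) \<^bold>* sq (x \<^bold>\<and> y) \<preceq> sq x \<^bold>* sq y" using assms by (intro fus_mono) auto
  then show "sq (x \<^bold>\<and> y) \<preceq> sq x \<^bold>* sq y"
    using rsq_idem[of "x \<^bold>\<and> y"] assms rsq_def[of A "sq (x \<^bold>\<and> y)"] by simp
  have "x \<^bold>* y \<preceq> x \<^bold>\<and> y" using assms by (auto intro: le_meetI fus_le1 fus_le2)
  then show "sq x \<^bold>* sq y \<preceq> sq (x \<^bold>\<and> y)"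
    using assms rsq_mono by (simp flip: rsq_fus)
qed (use assms in auto)

lemma rsq_join:
  assumes x: "x \<in> carrier A" and y: "y \<in> carrier A"
  shows "sq (x \<^bold>\<or> y) = sq (sq x \<^bold>\<or> sq y)"
proof (rule le_antisym)
  let ?j = "x \<^bold>\<or> y" and ?k = "sq x \<^bold>\<or> sq y"
  text \<open>Each of the monomials \<open>x\<^sup>3\<close>, \<open>x\<^sup>2y\<close>, \<open>xy\<^sup>2\<close>, \<open>y\<^sup>3\<close> contains a square of \<open>x\<close> or \<open>y\<close>.\<close>
  have a: "z \<preceq> ?k" if "z \<preceq> sq x \<or> z \<preceq> sq y" "z \<in> carrier A" for z
    using that x y le_trans[OF _ join_ge1[of "sq x" "sq y"]] le_trans[OF _ join_ge2[of "sq x" "sq y"]]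
    by auto
  have b: "sq x \<^bold>* z \<preceq> ?k" "sq y \<^bold>* z \<preceq> ?k" if "z \<in> carrier A" for z
    using that x y by (auto intro!: a fus_le1)
  \<comment> \<open>The cube of the join is expanded one factor at a time: here two letters and one
    join, next one letter and two joins.\<close>
  have c: "(u \<^bold>* v) \<^bold>* ?j \<preceq> ?k" if "u \<in> {x, y}" "v \<in> {x, y}" for u v
  proof -
    have "x \<^bold>* (u \<^bold>* v) \<preceq> ?k" "y \<^bold>* (u \<^bold>* v) \<preceq> ?k"
      using that x y b[of x] b[of y] by (auto simp: rsq_def fus_ac)
    then have "?j \<^bold>* (u \<^bold>* v) \<preceq> ?k" using that x y by (intro fus_join_leI) auto
    then show ?thesis using that x y fus_commute[of "u \<^bold>* v" ?j] by auto
  qed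
  have d: "u \<^bold>* (?j \<^bold>* ?j) \<preceq> ?k" if "u \<in> {x, y}" for u
  proof -
    have "?j \<^bold>* (u \<^bold>* ?j) \<preceq> ?k"
      using that x y c[of u x] c[of u y]
      by (intro fus_join_leI) (auto simp: fus_ac)
    then show ?thesis using that x y fus_left_commute[of u ?j ?j] by auto
  qed
  have "?j \<^bold>* (?j \<^bold>* ?j) \<preceq> ?k" using d x y by (intro fus_join_leI) auto
  \<comment> \<open>The fourth power lies below the third, and by idempotence the fourth power is
    \<open>sq ?j\<close> itself.\<close>
  moreover have "sq (sq ?j) \<preceq> ?j \<^bold>* (?j \<^bold>* ?j)"
    using fus_le1[of "?j \<^bold>* (?j \<^bold>* ?j)" ?j] x y by (simp add: rsq_def fus_assoc)
  ultimately have "sq ?j \<preceq> ?k" using x y le_trans[of "sq ?j" "?j \<^bold>* (?j \<^bold>* ?j)" ?k] by simp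
  then show "sq ?j \<preceq> sq ?k" using x y by (simp add: le_rsq_iff)
  have "sq x \<preceq> ?j" "sq y \<preceq> ?j"
    using x y le_trans[OF rsq_le join_ge1] le_trans[OF rsq_le join_ge2] by auto
  then show "sq ?k \<preceq> sq ?j" using x y by (intro rsq_mono join_leI) auto
qed (use x y in auto)

text \<open>The twist formula for the first component of an implication. For \<le>, implications
  pass to squares; this is applied to \<open>x \<Rightarrow> y\<close> and to its contrapositive.
  For the converse, the two implications between squares weaken to the premises of the Nelson
  inequality.\<close>

lemma rsq_res:
  assumes x: "x \<in> carrier A" and y: "y \<in> carrier A"
  shows "sq (x \<^bold>\<Rightarrow> y) = sq (sq x \<^bold>\<Rightarrow> sq y) \<^bold>* sq (sq (\<^bold>\<sim> y) \<^bold>\<Rightarrow> sq (\<^bold>\<sim> x))"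
proof (rule le_antisym)
  let ?u = "sq x \<^bold>\<Rightarrow> sq y" and ?v = "sq (\<^bold>\<sim> y) \<^bold>\<Rightarrow> sq (\<^bold>\<sim> x)"
  have *: "sq (p \<^bold>\<Rightarrow> q) \<preceq> sq p \<^bold>\<Rightarrow> sq q" if "p \<in> carrier A" "q \<in> carrier A" for p q
    using that rsq_mono[OF res_fus_le[of p q]] by (simp add: rsq_fus flip: residuation)
  have "x \<^bold>\<Rightarrow> y = \<^bold>\<sim> y \<^bold>\<Rightarrow> \<^bold>\<sim> x"
    using x y by (simp add: res_eq_rneg_fus involutive fus_commute)
  then have "sq (x \<^bold>\<Rightarrow> y) \<preceq> ?u \<^bold>\<and> ?v"
    using x y *[of x y] *[of "\<^bold>\<sim> y" "\<^bold>\<sim> x"] by (intro le_meetI) auto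
  then have "sq (x \<^bold>\<Rightarrow> y) \<preceq> sq (?u \<^bold>\<and> ?v)" using x y by (simp add: le_rsq_iff)
  then show "sq (x \<^bold>\<Rightarrow> y) \<preceq> sq ?u \<^bold>* sq ?v" using x y by (simp add: rsq_meet)
  have **: "p \<^bold>\<Rightarrow> sq q \<preceq> p \<^bold>\<Rightarrow> q" if "p \<in> carrier A" "q \<in> carrier A" for p q
    using that le_trans[OF res_fus_le[of p "sq q"] rsq_le[of q]] by (simp flip: residuation)
  have "?u \<^bold>\<and> ?v \<preceq> (sq x \<^bold>\<Rightarrow> y) \<^bold>\<and> (sq (\<^bold>\<sim> y) \<^bold>\<Rightarrow> \<^bold>\<sim> x)"
    using x y **[of "sq x" y] **[of "sq (\<^bold>\<sim> y)" "\<^bold>\<sim> x"]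
      le_trans[OF meet_le1[of ?u ?v]] le_trans[OF meet_le2[of ?u ?v]]
    by (intro le_meetI) auto
  then have "?u \<^bold>\<and> ?v \<preceq> x \<^bold>\<Rightarrow> y" using x y le_trans[OF _ nelson_le[of x y]] by simp
  then show "sq ?u \<^bold>* sq ?v \<preceq> sq (x \<^bold>\<Rightarrow> y)"
    using x y rsq_mono by (simp flip: rsq_meet)
qed (use x y in auto)

text \<open>Injectivity of the representation by pairs. Equal squares give
  \<open>sq p \<le> q\<close> and \<open>sq (\<sim> q) \<le> \<sim> p\<close>, so both Nelson
  premises are \<top> and \<open>p \<le> q\<close>; the situation is symmetric.\<close>

lemma eq_if_rsq_eq:
  assumes x: "x \<in> carrier A" and y: "y \<in> carrier A"
    and "sq x = sq y" and "sq (\<^bold>\<sim> x) = sq (\<^bold>\<sim> y)"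
  shows "x = y"
proof -
  have *: "p \<preceq> q" if "p \<in> carrier A" "q \<in> carrier A" "sq p = sq q" "sq (\<^bold>\<sim> p) = sq (\<^bold>\<sim> q)" for p q
  proof -
    have "\<^bold>\<top> \<preceq> sq p \<^bold>\<Rightarrow> q" "\<^bold>\<top> \<preceq> sq (\<^bold>\<sim> q) \<^bold>\<Rightarrow> \<^bold>\<sim> p"
      using that rsq_le[of q] rsq_le[of "\<^bold>\<sim> p"] by (simp_all flip: residuation)
    then have "\<^bold>\<top> \<preceq> (sq p \<^bold>\<Rightarrow> q) \<^bold>\<and> (sq (\<^bold>\<sim> q) \<^bold>\<Rightarrow> \<^bold>\<sim> p)" using that by (intro le_meetI) auto
    then have "\<^bold>\<top> \<preceq> p \<^bold>\<Rightarrow> q" using that le_trans[OF _ nelson_le[of p q]] by simp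
    then show ?thesis using that by (simp flip: residuation)
  qed
  show ?thesis using * assms by (intro le_antisym) auto
qed

end


section \<open>The algebra of squares as a modal Heyting algebra\<close>

text \<open>A square represents all elements having that square, in place of a quotient class, so
  the element type stays \<open>'a\<close>. Fusion of squares is a square; the remaining operations
  are followed by \<open>sq\<close> to land in the carrier.\<close>

definition square_algebra ::
    "('a, 'r) modal_residuated_alg_scheme \<Rightarrow> 'a modal_heyting_alg" where
  "square_algebra A = \<lparr>
     carrier = sq\<^bsub>A\<^esub> ` carrier A,
     lmeet = (\<^bold>*\<^bsub>A\<^esub>),
     ljoin = (\<lambda>x y. sq\<^bsub>A\<^esub> (x \<^bold>\<or>\<^bsub>A\<^esub> y)),
     ltop = \<^bold>\<top>\<^bsub>A\<^esub>,
     lbot = \<^bold>\<bottom>\<^bsub>A\<^esub>,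
     himp = (\<lambda>x y. sq\<^bsub>A\<^esub> (x \<^bold>\<Rightarrow>\<^bsub>A\<^esub> y)),
     hbox = (\<lambda>x. sq\<^bsub>A\<^esub> (\<^bold>\<box>\<^bsub>A\<^esub> x)),
     hdia = (\<lambda>x. sq\<^bsub>A\<^esub> (\<^bold>\<diamond>\<^bsub>A\<^esub> x))\<rparr>"

lemma square_algebra_simps [simp]:
  "carrier (square_algebra A) = sq\<^bsub>A\<^esub> ` carrier A"
  "x \<^bold>\<and>\<^bsub>square_algebra A\<^esub> y = x \<^bold>*\<^bsub>A\<^esub> y"
  "x \<^bold>\<or>\<^bsub>square_algebra A\<^esub> y = sq\<^bsub>A\<^esub> (x \<^bold>\<or>\<^bsub>A\<^esub> y)"
  "\<^bold>\<top>\<^bsub>square_algebra A\<^esub> = \<^bold>\<top>\<^bsub>A\<^esub>"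
  "\<^bold>\<bottom>\<^bsub>square_algebra A\<^esub> = \<^bold>\<bottom>\<^bsub>A\<^esub>"
  "x \<rightharpoonup>\<^bsub>square_algebra A\<^esub> y = sq\<^bsub>A\<^esub> (x \<^bold>\<Rightarrow>\<^bsub>A\<^esub> y)"
  "\<^bold>-\<^bsub>square_algebra A\<^esub> x = sq\<^bsub>A\<^esub> (\<^bold>\<sim>\<^bsub>A\<^esub> x)"
  "\<box>\<^bsub>square_algebra A\<^esub> x = sq\<^bsub>A\<^esub> (\<^bold>\<box>\<^bsub>A\<^esub> x)"
  "\<diamond>\<^bsub>square_algebra A\<^esub> x = sq\<^bsub>A\<^esub> (\<^bold>\<diamond>\<^bsub>A\<^esub> x)"
  by (simp_all add: square_algebra_def hneg_def rneg_def)


context modal_nelson_lattice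
begin

notation lle (infix \<open>\<preceq>\<close> 50)

lemma square_algebra_lattice: "lattice_algebra (square_algebra A)"
proof -
  let ?C = "sq ` carrier A"
  \<comment> \<open>\<open>rsq_join\<close> absorbs an inner \<open>sq\<close>, which reduces the
    claim to associativity of \<or> in the Nelson lattice.\<close>
  have join_assoc: "sq (sq (x \<^bold>\<or> y) \<^bold>\<or> z) = sq (x \<^bold>\<or> sq (y \<^bold>\<or> z))"
    if "x \<in> ?C" "y \<in> ?C" "z \<in> ?C" for x y z
  proof -
    have "sq (sq (x \<^bold>\<or> y) \<^bold>\<or> z) = sq ((x \<^bold>\<or> y) \<^bold>\<or> z)"
      using that rsq_join[of "x \<^bold>\<or> y" z] by (simp add: mem_squares_iff)
    also have "\<dots> = sq (x \<^bold>\<or> (y \<^bold>\<or> z))"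
      using that by (simp add: mem_squares_iff join_associative)
    also have "\<dots> = sq (x \<^bold>\<or> sq (y \<^bold>\<or> z))"
      using that rsq_join[of x "y \<^bold>\<or> z"] by (simp add: mem_squares_iff)
    finally show ?thesis .
  qed
  have "x \<^bold>* sq (x \<^bold>\<or> y) = x" if "x \<in> ?C" "y \<in> ?C" for x y
    using that by (simp add: mem_squares_iff idempotent_le_iff le_rsq_iff)
  moreover have "sq (x \<^bold>\<or> x \<^bold>* y) = x" if "x \<in> ?C" "y \<in> ?C" for x y
    using that fus_le1[of x y] le_iff_join[of "x \<^bold>* y" x] join_commute[of x "x \<^bold>* y"]
    by (simp add: mem_squares_iff)
  ultimately show ?thesis
    unfolding lattice_algebra_iff square_algebra_simps using join_assoc
    by (simp add: mem_squares_iff rsq_fus fus_ac join_commute)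
qed

text \<open>On idempotents the new order is that of \<open>A\<close> by
  \<open>idempotent_le_iff\<close>, and \<open>le_rsq_iff\<close> removes the \<open>sq\<close>
  around the implication; what remains is residuation in \<open>A\<close>.\<close>

lemma square_algebra_heyting: "heyting_algebra (square_algebra A)"
proof (intro heyting_algebra.intro square_algebra_lattice heyting_algebra_axioms.intro)
  fix x y z
  assume "x \<in> carrier (square_algebra A)" "y \<in> carrier (square_algebra A)"
    "z \<in> carrier (square_algebra A)"
  then show "x \<^bold>\<and>\<^bsub>square_algebra A\<^esub> y \<sqsubseteq>\<^bsub>lat_order (square_algebra A)\<^esub> z \<longleftrightarrow>
      x \<sqsubseteq>\<^bsub>lat_order (square_algebra A)\<^esub> (y \<rightharpoonup>\<^bsub>square_algebra A\<^esub> z)"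
    by (simp add: lattice_algebra.le_iff_meet[OF square_algebra_lattice] mem_squares_iff
        idempotent_le_iff le_rsq_iff rsq_fus residuation)
qed (simp add: mem_squares_iff)

declare nbox_closed [simp] ndia_closed [simp]

text \<open>\<open>x\<close> and \<open>sq x\<close> have equal squares, so the congruence axiom
  applies. It lets the squared box act on representatives.\<close>

lemma rsq_nbox_rsq: "x \<in> carrier A \<Longrightarrow> sq (\<^bold>\<box> (sq x)) = sq (\<^bold>\<box> x)"
  by (intro nbox_sq) auto

lemma rsq_ndia_rsq: "x \<in> carrier A \<Longrightarrow> sq (\<^bold>\<diamond> (sq x)) = sq (\<^bold>\<diamond> x)"
  by (intro ndia_sq) auto

lemma rneg_nbox: "x \<in> carrier A \<Longrightarrow> \<^bold>\<sim> (\<^bold>\<box> x) = \<^bold>\<diamond> (\<^bold>\<sim> x)"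
  by (simp add: ndia_eq involutive)

lemma rneg_ndia: "x \<in> carrier A \<Longrightarrow> \<^bold>\<sim> (\<^bold>\<diamond> x) = \<^bold>\<box> (\<^bold>\<sim> x)"
  by (simp add: ndia_eq involutive)

lemma square_algebra_modal: "modal_heyting_algebra (square_algebra A)"
proof (intro modal_heyting_algebra.intro square_algebra_heyting
    modal_heyting_algebra_axioms.intro)
  fix x y
  assume "x \<in> carrier (square_algebra A)" "y \<in> carrier (square_algebra A)"
  then have xy: "x \<in> carrier A" "sq x = x" "y \<in> carrier A" "sq y = y"
    by (auto simp: mem_squares_iff)
  \<comment> \<open>The Heyting meet becomes the square of a lattice meet, the form found in the
    modal axiom; \<open>rsq_ndia_rsq\<close> then removes that square under the diamond.\<close>
  have "sq (\<^bold>\<sim> x) \<^bold>* y = sq (\<^bold>\<sim> x \<^bold>\<and> y)" using xy by (simp add: rsq_meet)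
  then have "sq (\<^bold>\<box> x) \<^bold>* sq (\<^bold>\<diamond> (sq (\<^bold>\<sim> x) \<^bold>* y)) = sq (\<^bold>\<box> x \<^bold>\<and> \<^bold>\<diamond> (\<^bold>\<sim> (sq x) \<^bold>\<and> y))"
    using xy rsq_ndia_rsq[of "\<^bold>\<sim> x \<^bold>\<and> y"] by (simp add: rsq_meet)
  also have "\<dots> = \<^bold>\<bottom>" using xy by (intro nbox_ndia)
  finally show "\<box>\<^bsub>square_algebra A\<^esub> x \<^bold>\<and>\<^bsub>square_algebra A\<^esub>
      \<diamond>\<^bsub>square_algebra A\<^esub> (\<^bold>-\<^bsub>square_algebra A\<^esub> x \<^bold>\<and>\<^bsub>square_algebra A\<^esub> y) = \<^bold>\<bottom>\<^bsub>square_algebra A\<^esub>"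
    by simp
qed (auto simp: mem_squares_iff)

section \<open>Density from \<Delta> = \<nabla> and the twist representation\<close>

lemma rsq_dense:
  assumes x: "x \<in> carrier A" and eq: "\<Delta> x = \<nabla> x"
  shows "sq (\<^bold>\<sim> (sq (sq x \<^bold>\<or> sq (\<^bold>\<sim> x)))) = \<^bold>\<bottom>"
proof -
  interpret S: heyting_algebra "square_algebra A" by (rule square_algebra_heyting)
  have "sq (\<^bold>\<sim> (sq (sq x \<^bold>\<or> sq (\<^bold>\<sim> x)))) = sq (\<^bold>\<sim> (sq x)) \<^bold>* sq (\<^bold>\<sim> (sq (\<^bold>\<sim> x)))"
    using x S.hneg_join[of "sq x" "sq (\<^bold>\<sim> x)"] by simp
  \<comment> \<open>The second factor is \<open>\<Delta> x\<close>; replaced by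
    \<open>\<nabla> x\<close> it becomes the negation of the first factor.\<close>
  also have "\<dots> = sq (\<^bold>\<sim> (sq x)) \<^bold>* \<^bold>\<sim> (sq (\<^bold>\<sim> (sq x)))"
    using eq by (simp add: delta_def nabla_def)
  also have "\<dots> = \<^bold>\<bottom>" using x by (simp add: fus_commute[of "sq (\<^bold>\<sim> (sq x))"])
  finally show ?thesis .
qed

lemma square_algebra_duality:
  assumes eq: "\<And>x. x \<in> carrier A \<Longrightarrow> \<Delta> x = \<nabla> x"
  shows "double_negation_dual (square_algebra A)"
proof -
  interpret S: heyting_algebra "square_algebra A" by (rule square_algebra_heyting)
  \<comment> \<open>The element \<open>\<box> x\<close> is represented by the squares of
    \<open>\<box> x\<close> and \<open>\<diamond> (\<sim> x)\<close>, whose join is dense by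
    \<open>rsq_dense\<close>.\<close>
  have dual: "sq (\<^bold>\<sim> (sq (\<^bold>\<diamond> (\<^bold>\<sim> x)))) = sq (\<^bold>\<sim> (sq (\<^bold>\<sim> (sq (\<^bold>\<box> x)))))"
    if x: "x \<in> carrier A" for x
    using S.hneg_eq_of_dense_join[of "sq (\<^bold>\<box> x)" "sq (\<^bold>\<sim> (\<^bold>\<box> x))"] x
      rsq_disjoint[of "\<^bold>\<box> x"] rsq_dense[of "\<^bold>\<box> x"] eq[of "\<^bold>\<box> x"]
    by (simp add: rneg_nbox)
  show ?thesis
    unfolding double_negation_dual_def square_algebra_simps mem_squares_iff
  proof (intro ballI conjI)
    fix a assume "a \<in> sq ` carrier A"
    then have a: "a \<in> carrier A" "sq a = a" by (auto simp: mem_squares_iff)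
    show "sq (\<^bold>\<sim> (sq (\<^bold>\<sim> (sq (\<^bold>\<box> a))))) = sq (\<^bold>\<sim> (sq (\<^bold>\<diamond> (sq (\<^bold>\<sim> a)))))"
      using dual[of a] a by (simp add: rsq_ndia_rsq)
    \<comment> \<open>Duality at \<open>\<sim> a\<close> reads
      \<open>-\<diamond> a = --\<box> -a\<close>; one more negation and the triple negation law give
      the second identity.\<close>
    have "sq (\<^bold>\<sim> (sq (\<^bold>\<diamond> a))) = sq (\<^bold>\<sim> (sq (\<^bold>\<sim> (sq (\<^bold>\<box> (sq (\<^bold>\<sim> a)))))))"
      using dual[of "\<^bold>\<sim> a"] a by (simp add: involutive rsq_nbox_rsq)
    then show "sq (\<^bold>\<sim> (sq (\<^bold>\<box> (sq (\<^bold>\<sim> a))))) = sq (\<^bold>\<sim> (sq (\<^bold>\<sim> (sq (\<^bold>\<diamond> a)))))"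
      using S.hneg_triple[of "sq (\<^bold>\<box> (sq (\<^bold>\<sim> a)))"] a by simp
  qed
qed

text \<open>Let \<open>d\<close> be the join of \<open>a\<close> and \<open>b\<close> among squares.
  As pairs, \<open>a\<close> is \<open>(a, -a)\<close> and, by density, \<open>\<sim> d\<close> is
  \<open>(\<bottom>, d)\<close>, so the witness is \<open>(a, -a \<and> d)\<close>. Distributing
  \<open>-a\<close> over \<open>d\<close> kills \<open>a\<close> and leaves \<open>b\<close>, which
  lies below \<open>-a\<close>.\<close>

lemma twist_square_algebra_preimage:
  assumes a: "a \<in> carrier A" "sq a = a" and b: "b \<in> carrier A" "sq b = b"
    and disj: "a \<^bold>* b = \<^bold>\<bottom>" and dense: "sq (\<^bold>\<sim> (sq (a \<^bold>\<or> b))) = \<^bold>\<bottom>"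
  defines "x \<equiv> a \<^bold>\<or> \<^bold>\<sim> (sq (a \<^bold>\<or> b))"
  shows "x \<in> carrier A" "sq x = a" "sq (\<^bold>\<sim> x) = b"
proof -
  show "x \<in> carrier A" using a b by (simp add: x_def)
  show "sq x = a" using a b dense rsq_join[of a "\<^bold>\<sim> (sq (a \<^bold>\<or> b))"] by (simp add: x_def)
  let ?n = "sq (\<^bold>\<sim> a)" and ?d = "sq (a \<^bold>\<or> b)"
  have "sq (\<^bold>\<sim> x) = ?n \<^bold>* ?d"
    using a b by (simp add: x_def rneg_join involutive rsq_meet)
  also have "\<dots> = b"
  proof (rule le_antisym)
    have "a \<^bold>* ?n = \<^bold>\<bottom>" using a rsq_disjoint[of a] by simp
    then have "a \<^bold>* ?n \<preceq> b" using b by simp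
    moreover have "b \<^bold>* ?n \<preceq> b" using a b by (simp add: fus_le1)
    ultimately have "(a \<^bold>\<or> b) \<^bold>* ?n \<preceq> b" using a b by (intro fus_join_leI) auto
    moreover have "?d \<^bold>* ?n \<preceq> (a \<^bold>\<or> b) \<^bold>* ?n" using a b by (intro fus_mono_left rsq_le) auto
    ultimately have "?d \<^bold>* ?n \<preceq> b" using a b le_trans[of "?d \<^bold>* ?n" "(a \<^bold>\<or> b) \<^bold>* ?n"] by simp
    then show "?n \<^bold>* ?d \<preceq> b" using a b by (simp add: fus_commute)
    have "b \<preceq> ?n" "b \<preceq> ?d"
      using a b disj by (simp_all add: le_rsq_iff le_rneg_iff fus_commute)
    then have "b \<^bold>* b \<preceq> ?n \<^bold>* ?d" using a b by (intro fus_mono) auto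
    then show "b \<preceq> ?n \<^bold>* ?d" using b by (simp flip: rsq_def)
  qed (use a b in auto)
  finally show "sq (\<^bold>\<sim> x) = b" .
qed

lemma isomorphic_twist_square_algebra:
  assumes eq: "\<And>x. x \<in> carrier A \<Longrightarrow> \<Delta> x = \<nabla> x"
  shows "modal_nelson_isomorphic A (twist (square_algebra A) (dense_elements (square_algebra A)))"
proof -
  let ?T = "twist (square_algebra A) (dense_elements (square_algebra A))"
  let ?h = "\<lambda>x. (sq x, sq (\<^bold>\<sim> x))"
  have T: "(a, b) \<in> carrier ?T \<longleftrightarrow> a \<in> carrier A \<and> sq a = a \<and> b \<in> carrier A \<and> sq b = b \<and>
      a \<^bold>* b = \<^bold>\<bottom> \<and> sq (\<^bold>\<sim> (sq (a \<^bold>\<or> b))) = \<^bold>\<bottom>" for a b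
    by (auto simp: twist_def dense_elements_def mem_squares_iff)
  have "bij_betw ?h (carrier A) (carrier ?T)"
    unfolding bij_betw_def
  proof (intro conjI equalityI subsetI)
    show "inj_on ?h (carrier A)" by (auto intro!: inj_onI eq_if_rsq_eq)
    show "p \<in> carrier ?T" if "p \<in> ?h ` carrier A" for p
      using that by (auto simp: T rsq_disjoint rsq_dense eq)
    fix p assume p: "p \<in> carrier ?T"
    obtain a b where [simp]: "p = (a, b)" by (cases p)
    show "p \<in> ?h ` carrier A"
      using p twist_square_algebra_preimage[of a b]
      by (auto simp: T intro!: image_eqI[where x = "a \<^bold>\<or> \<^bold>\<sim> (sq (a \<^bold>\<or> b))"])
  qed
  \<comment> \<open>Moving \<open>\<sim>\<close> past a modality switches box and diamond, which
    accounts for the opposite modality in the second component.\<close>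
  moreover have "?h (\<^bold>\<box> x) = \<^bold>\<box>\<^bsub>?T\<^esub> (?h x)" "?h (\<^bold>\<diamond> x) = \<^bold>\<diamond>\<^bsub>?T\<^esub> (?h x)" if "x \<in> carrier A" for x
    using that by (simp_all add: twist_def rneg_nbox rneg_ndia rsq_nbox_rsq rsq_ndia_rsq)
  moreover have "?h (x \<^bold>\<and> y) = ?h x \<^bold>\<and>\<^bsub>?T\<^esub> ?h y" "?h (x \<^bold>\<or> y) = ?h x \<^bold>\<or>\<^bsub>?T\<^esub> ?h y"
    if "x \<in> carrier A" "y \<in> carrier A" for x y
    using that rsq_join[of x y] rsq_join[of "\<^bold>\<sim> x" "\<^bold>\<sim> y"]
    by (simp_all add: twist_def rsq_meet rneg_join rneg_meet)
  moreover have "?h (x \<^bold>* y) = ?h x \<^bold>*\<^bsub>?T\<^esub> ?h y" "?h (x \<^bold>\<Rightarrow> y) = ?h x \<^bold>\<Rightarrow>\<^bsub>?T\<^esub> ?h y"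
    if xy: "x \<in> carrier A" "y \<in> carrier A" for x y
  proof -
    \<comment> \<open>Since \<open>\<sim> (x * y) = x \<Rightarrow> \<sim> y\<close>, the second
      component of a fusion is \<open>rsq_res\<close> at \<open>\<sim> y\<close>.\<close>
    show "?h (x \<^bold>* y) = ?h x \<^bold>*\<^bsub>?T\<^esub> ?h y"
      using xy rsq_res[of x "\<^bold>\<sim> y"] by (simp add: twist_def rsq_fus rneg_fus_eq_res involutive)
    have "sq (\<^bold>\<sim> (x \<^bold>\<Rightarrow> y)) = sq x \<^bold>* sq (\<^bold>\<sim> y)"
      using xy by (simp add: res_eq_rneg_fus involutive rsq_fus)
    then show "?h (x \<^bold>\<Rightarrow> y) = ?h x \<^bold>\<Rightarrow>\<^bsub>?T\<^esub> ?h y"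
      using xy rsq_res[of x y] by (simp add: twist_def)
  qed
  moreover have "?h \<^bold>\<top> = \<^bold>\<top>\<^bsub>?T\<^esub>" "?h \<^bold>\<bottom> = \<^bold>\<bottom>\<^bsub>?T\<^esub>"
    by (simp_all add: twist_def)
  ultimately have "?h \<in> modal_nelson_iso A ?T"
    unfolding modal_nelson_iso_def by blast
  then show ?thesis unfolding modal_nelson_isomorphic_def by blast
qed

end


text \<open>An existential quantifier in HOL cannot range over types. The witness is therefore
  sought over the element type of \<open>N\<close>, where the squares live, and the second conjunct
  gives the converse for \<open>M\<close> over any type \<open>'b\<close>.\<close>

theorem theorem9:
  fixes N :: "'a modal_residuated_alg"
  assumes "modal_nelson_lattice N"
  shows "((\<forall>x\<in>carrier N. \<Delta>\<^bsub>N\<^esub> x = \<nabla>\<^bsub>N\<^esub> x) \<longleftrightarrow>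
      (\<exists>M :: 'a modal_heyting_alg. modal_heyting_algebra M \<and> double_negation_dual M \<and>
        modal_nelson_isomorphic N (twist M (dense_elements M)))) \<and>
    (\<forall>M :: 'b modal_heyting_alg. modal_heyting_algebra M \<and> double_negation_dual M \<and>
        modal_nelson_isomorphic N (twist M (dense_elements M)) \<longrightarrow>
      (\<forall>x\<in>carrier N. \<Delta>\<^bsub>N\<^esub> x = \<nabla>\<^bsub>N\<^esub> x))"
proof (intro conjI iffI)
  interpret modal_nelson_lattice N by fact
  assume "\<forall>x\<in>carrier N. \<Delta>\<^bsub>N\<^esub> x = \<nabla>\<^bsub>N\<^esub> x"
  then show "\<exists>M :: 'a modal_heyting_alg. modal_heyting_algebra M \<and> double_negation_dual M \<and>
      modal_nelson_isomorphic N (twist M (dense_elements M))"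
    using square_algebra_modal square_algebra_duality isomorphic_twist_square_algebra by blast
next
  show "\<forall>x\<in>carrier N. \<Delta>\<^bsub>N\<^esub> x = \<nabla>\<^bsub>N\<^esub> x"
    if "\<exists>M :: 'a modal_heyting_alg. modal_heyting_algebra M \<and> double_negation_dual M \<and>
        modal_nelson_isomorphic N (twist M (dense_elements M))"
    using that by (metis assms delta_eq_nabla_if_isomorphic_twist modal_heyting_algebra.axioms(1))
  show "\<forall>M :: 'b modal_heyting_alg. modal_heyting_algebra M \<and> double_negation_dual M \<and>
        modal_nelson_isomorphic N (twist M (dense_elements M)) \<longrightarrow>
      (\<forall>x\<in>carrier N. \<Delta>\<^bsub>N\<^esub> x = \<nabla>\<^bsub>N\<^esub> x)"
    by (metis assms delta_eq_nabla_if_isomorphic_twist modal_heyting_algebra.axioms(1))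
qed

end
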